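(* Let $\mathbb{K}$ be a field, $c\in\mathbb{N}$ and $R=\mathbb{K}[x_{i,j}\mid 1\le i\le c,\ j\in\mathbb{N}]$. For every $\mathrm{Inc}(\mathbb{N})$-invariant ideal chain $J_\circ=J_1\subseteq J_2\subseteq\dots$ in $R$, the set $$\mathrm{I}(J_\circ)=\{\mathrm{Ind}(\mathrm{in}_\preceq(J_\circ))\mid\ \preceq\text{ is an }\mathrm{Inc}(\mathbb{N})\text{-compatible term order on }R\}$$ is bounded above (and, thus, finite).
   Context: $\mathbb{N}=\{1,2,3,\dots\}$ and $[n]=\{1,\dots,n\}$. $R_n=\mathbb{K}[x_{i,j}\mid i\in[c],j\in[n]]\subseteq R$. $\mathrm{Inc}(\mathbb{N})$ is the monoid of strictly increasing functions $p:\mathbb{N}\to\mathbb{N}$; it acts on $R$ by $\mathbb{K}$-linear extension of $p\cdot(x_{i_1,j_1}^{e_1}\cdots x_{i_r,j_r}^{e_r})=x_{i_1,p(j_1)}^{e_1}\cdots x_{i_r,p(j_r)}^{e_r}$. For $m\le n$, $\mathrm{Inc}(\mathbb{N})_{m,n}=\{p\in\mathrm{Inc}(\mathbb{N})\mid p(m)\le n\}$. For a set $P$ of maps and a set $F$ of polynomials, $P\cdot F=\{p\cdot f\mid p\in P,f\in F\}$, and $\langle F\rangle_{R_n}$ is the ideal of $R_n$ generated by $F$. An $\mathrm{Inc}(\mathbb{N})$-invariant ideal chain in $R$ is a sequence $J_\circ=J_1\subseteq J_2\subseteq\dots$ with each $J_n$ an ideal of $R_n$ and $\mathrm{Inc}(\mathbb{N})_{m,n}\cdot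 J_m\subseteq J_n$ for all $m\le n$. It is a known result (Hillar–Sullivant) that for every such chain there is $N\in\mathbb{N}$ with $\langle\mathrm{Inc}(\mathbb{N})_{N,n}\cdot J_N\rangle_{R_n}=J_n$ for all $n\ge N$; the minimal such $N$ is the stability index $\mathrm{Ind}(J_\circ)$. A term order $\preceq$ on $R$ is a total order on the monomials of $R$ that respects multiplication and satisfies $1\preceq f$ for every monomial $f$. It is $\mathrm{Inc}(\mathbb{N})$-compatible if $f\preceq g$ implies $p\cdot f\preceq p\cdot g$ for all monomials $f,g\in R$ and all $p\in\mathrm{Inc}(\mathbb{N})$. $\mathrm{in}_\preceq(f)$ denotes the leading (i.e. $\preceq$-largest) monomial of a nonzero polynomial $f$, and $\mathrm{in}_\preceq(J_n)$ is the ideal of $R_n$ generated by the leading monomials of the nonzero elements of $J_n$. For an $\mathrm{Inc}(\mathbb{N})$-compatible term order, $\mathrm{in}_\preceq(J_\circ):=\mathrm{in}_\preceq(J_1)\subseteq\mathrm{in}_\preceq(J_2)\subseteq\dots$ is again an $\mathrm{Inc}(\mathbb{N})$-invariant ideal chain, so its stability index is defined. *)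

theory Defs
  imports "HOL-Library.Poly_Mapping" "HOL-Algebra.Ideal"
begin

text \<open>
  A monomial is its exponent function: the variable \<open>x\<^bsub>i,j\<^esub>\<close> has index \<open>(i, j)\<close>, the
  product of monomials is \<open>+\<close>, and the monomial 1 is \<open>0\<close>. A polynomial maps monomials to
  coefficients. The types admit all indices in \<open>nat \<times> nat\<close>; the sets below restrict to
  \<open>1 \<le> i \<le> c\<close> and \<open>j \<ge> 1\<close>.
\<close>

type_synonym mon = "(nat \<times> nat) \<Rightarrow>\<^sub>0 nat"
type_synonym 'k mpoly = "mon \<Rightarrow>\<^sub>0 'k"

definition monomials :: "nat \<Rightarrow> nat set \<Rightarrow> mon set" where
  "monomials c A = {t. Poly_Mapping.keys t \<subseteq> {1..c} \<times> A}"

definition poly_ring :: "nat \<Rightarrow> nat \<Rightarrow> 'k::field mpoly ring" where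
  "poly_ring c n =
    \<lparr>carrier = {f. Poly_Mapping.keys f \<subseteq> monomials c {1..n}},
     mult = (*), one = 1, zero = 0, add = (+)\<rparr>"

text \<open>The value \<open>p 0\<close> is unconstrained and never matters.\<close>

definition Inc :: "(nat \<Rightarrow> nat) set" where
  "Inc = {p. p ` {1..} \<subseteq> {1..} \<and> strict_mono_on {1..} p}"

definition Inc_between :: "nat \<Rightarrow> nat \<Rightarrow> (nat \<Rightarrow> nat) set" where
  "Inc_between m n = {p \<in> Inc. p m \<le> n}"

definition act_mon :: "(nat \<Rightarrow> nat) \<Rightarrow> mon \<Rightarrow> mon" where
  "act_mon p t =
    (\<Sum>(i, j)\<in>Poly_Mapping.keys t. Poly_Mapping.single (i, p j) (Poly_Mapping.lookup t (i, j)))"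

definition act :: "(nat \<Rightarrow> nat) \<Rightarrow> 'k::field mpoly \<Rightarrow> 'k mpoly" where
  "act p f =
    (\<Sum>t\<in>Poly_Mapping.keys f. Poly_Mapping.single (act_mon p t) (Poly_Mapping.lookup f t))"

definition act_set :: "(nat \<Rightarrow> nat) set \<Rightarrow> 'k::field mpoly set \<Rightarrow> 'k mpoly set" where
  "act_set P F = {act p f | p f. p \<in> P \<and> f \<in> F}"

text \<open>Chains are indexed from 1; the set \<open>J 0\<close> is unconstrained and never matters.\<close>

definition Inc_invariant_chain :: "nat \<Rightarrow> (nat \<Rightarrow> 'k::field mpoly set) \<Rightarrow> bool" where
  "Inc_invariant_chain c J \<longleftrightarrow>
    (\<forall>n\<ge>1. ideal (J n) (poly_ring c n)) \<and>
    (\<forall>m\<ge>1. \<forall>n\<ge>m. J m \<subseteq> J n \<and> act_set (Inc_between m n) (J m) \<subseteq> J n)"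

definition stability_index :: "nat \<Rightarrow> (nat \<Rightarrow> 'k::field mpoly set) \<Rightarrow> nat" where
  "stability_index c J =
    (LEAST N. N \<ge> 1 \<and>
      (\<forall>n\<ge>N. genideal (poly_ring c n) (act_set (Inc_between N n) (J N)) = J n))"

definition term_order :: "nat \<Rightarrow> mon rel \<Rightarrow> bool" where
  "term_order c r \<longleftrightarrow>
    linear_order_on (monomials c {1..}) r \<and>
    (\<forall>s t. \<forall>u\<in>monomials c {1..}. (s, t) \<in> r \<longrightarrow> (s + u, t + u) \<in> r) \<and>
    (\<forall>t\<in>monomials c {1..}. (0, t) \<in> r)"

definition Inc_compatible :: "mon rel \<Rightarrow> bool" where
  "Inc_compatible r \<longleftrightarrow> (\<forall>p\<in>Inc. \<forall>s t. (s, t) \<in> r \<longrightarrow> (act_mon p s, act_mon p t) \<in> r)"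

definition lead_mon :: "mon rel \<Rightarrow> 'k::field mpoly \<Rightarrow> mon" where
  "lead_mon r f =
    (THE t. t \<in> Poly_Mapping.keys f \<and> (\<forall>s\<in>Poly_Mapping.keys f. (s, t) \<in> r))"

definition initial_chain ::
    "nat \<Rightarrow> mon rel \<Rightarrow> (nat \<Rightarrow> 'k::field mpoly set) \<Rightarrow> nat \<Rightarrow> 'k mpoly set" where
  "initial_chain c r J n =
    genideal (poly_ring c n) {Poly_Mapping.single (lead_mon r f) 1 | f. f \<in> J n \<and> f \<noteq> 0}"

definition initial_indices :: "nat \<Rightarrow> (nat \<Rightarrow> 'k::field mpoly set) \<Rightarrow> nat set" where
  "initial_indices c J =
    {stability_index c (initial_chain c r J) | r. term_order c r \<and> Inc_compatible r}"

end

theory Submission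
  imports Defs "HOL-Library.Sublist" "HOL-Library.Countable_Set"
begin

text \<open>
  If the indices were unbounded, there would be a term order \<open>r\<close> that is a limit, in the topology of
  pointwise convergence, of orders with indices tending to infinity. By Higman's lemma the initial
  monomials with respect to \<open>r\<close> are generated, up to the action, by those of finitely many
  polynomials. Every order that agrees with \<open>r\<close> on the supports of these polynomials has at least the
  initial monomials of \<open>r\<close>, hence the same ones, since the standard monomials of both orders are bases
  of the quotients. Its index is therefore bounded, a contradiction.
\<close>

section \<open>Well-quasi-orders\<close>

text \<open>Agreement on finitely many polynomials has to control the infinitely many ideals
  \<open>J n\<close>. It does so because compatible orders move leading monomials along with the
  action, which spreads the agreement to every level. This yields only an inclusion between the sets
  of leading monomials, and an inclusion alone says nothing about generators for the larger set; the
  dimension count is what closes this gap. The limit can be built by successive decisions because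
  there are only countably many pairs of monomials. The bound \<open>N\<close> is the largest level
  among the generators for the limit order. It is fixed before the nearby order is picked, so that
  order may be required to have an index above \<open>N\<close>.\<close>

definition wqo :: "('a \<Rightarrow> 'a \<Rightarrow> bool) \<Rightarrow> bool" where
  "wqo P \<longleftrightarrow> (\<forall>f :: nat \<Rightarrow> 'a. \<exists>i j. i < j \<and> P (f i) (f j))"

lemma wqoE:
  fixes f :: "nat \<Rightarrow> 'a"
  assumes "wqo P"
  obtains i j where "i < j" and "P (f i) (f j)"
proof -
  have "\<exists>i j. i < j \<and> P (f i) (f j)" using assms unfolding wqo_def by (rule spec)
  then show thesis using that by blast
qed

lemma wqo_vimage:
  assumes "wqo P"
  shows "wqo (\<lambda>x y. P (h x) (h y))"
  unfolding wqo_def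
proof
  fix f :: "nat \<Rightarrow> 'b"
  obtain i j where "i < j" "P (h (f i)) (h (f j))"
    by (rule wqoE[OF assms, of "\<lambda>i. h (f i)"])
  then show "\<exists>i j. i < j \<and> P (h (f i)) (h (f j))" by blast
qed

text \<open>The indices without a later larger partner are finitely many, since otherwise they would
  enumerate a bad sequence. Beyond a bound \<open>b\<close> for them each index can be continued
  greedily, and transitivity extends the relation from neighbours to all pairs.\<close>

lemma wqo_monotone_subseq:
  fixes f :: "nat \<Rightarrow> 'a"
  assumes "wqo P" and "transp P"
  shows "\<exists>\<phi> :: nat \<Rightarrow> nat. strict_mono \<phi> \<and> (\<forall>i j. i < j \<longrightarrow> P (f (\<phi> i)) (f (\<phi> j)))"
proof -
  define T where "T = {i. \<forall>j>i. \<not> P (f i) (f j)}"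
  have "finite T"
  proof (rule ccontr)
    assume "infinite T"
    then have e: "enumerate T i \<in> T" "i < j \<Longrightarrow> enumerate T i < enumerate T j" for i j
      by (auto intro: enumerate_in_set enumerate_mono)
    obtain i j where "i < j" "P (f (enumerate T i)) (f (enumerate T j))"
      by (rule wqoE[OF assms(1), of "\<lambda>i. f (enumerate T i)"])
    with e show False unfolding T_def by blast
  qed
  then obtain b where b: "\<And>i. i \<in> T \<Longrightarrow> i < b"
    using finite_nat_bounded by (metis lessThan_iff subsetD)
  have "\<exists>\<phi>. \<forall>n. \<phi> n \<ge> b \<and> \<phi> n < \<phi> (Suc n) \<and> P (f (\<phi> n)) (f (\<phi> (Suc n)))"
  proof -
    have "\<exists>y. y \<ge> b \<and> x < y \<and> P (f x) (f y)" if "x \<ge> b" for x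
    proof -
      have "x \<notin> T" using b[of x] that by auto
      then obtain y where "x < y" "P (f x) (f y)" unfolding T_def by blast
      with that show ?thesis by (intro exI[of _ y]) auto
    qed
    then have "\<exists>\<phi>. \<forall>n. \<phi> n \<ge> b \<and> (\<phi> n < \<phi> (Suc n) \<and> P (f (\<phi> n)) (f (\<phi> (Suc n))))"
      by (intro dependent_nat_choice[where P = "\<lambda>_ x. x \<ge> b" and
            Q = "\<lambda>_ x y. x < y \<and> P (f x) (f y)"]) fastforce+
    then show ?thesis by blast
  qed
  then obtain \<phi> :: "nat \<Rightarrow> nat" where \<phi>: "\<And>n. \<phi> n < \<phi> (Suc n)" "\<And>n. P (f (\<phi> n)) (f (\<phi> (Suc n)))"
    by blast
  show ?thesis
  proof (intro exI[of _ \<phi>] conjI allI impI)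
    show "strict_mono \<phi>" using \<phi>(1) by (simp add: strict_mono_Suc_iff)
    show "P (f (\<phi> i)) (f (\<phi> j))" if "i < j" for i j
      using that
    proof (induction j)
      case (Suc j)
      then show ?case
        using \<phi>(2)[of j] transpD[OF assms(2)] by (cases "i = j") auto
    qed simp
  qed
qed

lemma wqo_le_nat: "wqo ((\<le>) :: nat \<Rightarrow> nat \<Rightarrow> bool)"
  unfolding wqo_def
proof
  fix f :: "nat \<Rightarrow> nat"
  obtain i where i: "f i \<le> f j" for j
    using ex_has_least_nat[of "\<lambda>_. True" 0 f] by auto
  have "i < Suc i \<and> f i \<le> f (Suc i)" by (simp add: i)
  then show "\<exists>i j. i < j \<and> f i \<le> f j" by blast
qed

text \<open>Dickson's lemma. For a new coordinate \<open>x\<close>, pass first to a subsequence that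
  is monotone there.\<close>

lemma wqo_pointwise:
  assumes "finite K"
  shows "wqo (\<lambda>u v :: 'a \<Rightarrow> nat. \<forall>k\<in>K. u k \<le> v k)"
  using assms
proof (induction K)
  case (insert x K)
  show ?case
    unfolding wqo_def
  proof
    fix f :: "nat \<Rightarrow> 'a \<Rightarrow> nat"
    obtain \<phi> :: "nat \<Rightarrow> nat" where \<phi>: "strict_mono \<phi>" "\<And>i j. i < j \<Longrightarrow> f (\<phi> i) x \<le> f (\<phi> j) x"
      using wqo_monotone_subseq[OF wqo_le_nat transp_on_le, of "\<lambda>i. f i x"] by blast
    obtain i j :: nat where "i < j" "\<forall>k\<in>K. f (\<phi> i) k \<le> f (\<phi> j) k"
      by (rule wqoE[OF insert.IH, of "\<lambda>i. f (\<phi> i)"])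
    with \<phi> have "\<phi> i < \<phi> j \<and> (\<forall>k\<in>insert x K. f (\<phi> i) k \<le> f (\<phi> j) k)"
      by (auto simp: strict_mono_def)
    then show "\<exists>i j. i < j \<and> (\<forall>k\<in>insert x K. f i k \<le> f j k)"
      by blast
  qed
qed (auto simp: wqo_def)

text \<open>Higman's lemma, by the minimal bad sequence argument of Nash-Williams.\<close>

lemma wqo_list_emb:
  fixes P :: "'a \<Rightarrow> 'a \<Rightarrow> bool"
  assumes "wqo P" and "transp P"
  shows "wqo (list_emb P)"
proof (rule ccontr)
  assume "\<not> wqo (list_emb P)"
  define bad where "bad f \<longleftrightarrow> (\<forall>i j. i < j \<longrightarrow> \<not> list_emb P (f i) (f j))" for f :: "nat \<Rightarrow> 'a list"
  have ex: "\<exists>f. bad f" using \<open>\<not> wqo _\<close> unfolding wqo_def bad_def by blast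
  \<comment> \<open>Entry \<open>n\<close> of the bad sequence \<open>F\<close> is as short as the
    entries before it permit. Whole sequences are chosen at each stage, so that a bad continuation
    is always at hand; the diagonal \<open>g\<close> is the minimal bad sequence.\<close>
  define M where "M n F \<longleftrightarrow> bad F \<and>
    (\<forall>h. bad h \<and> (\<forall>i<n. h i = F i) \<longrightarrow> length (F n) \<le> length (h n))" for n F
  have min: "\<exists>F'. M n F' \<and> (\<forall>i<n. F' i = F i)" if "bad F" for n F
  proof -
    let ?Q = "\<lambda>h. bad h \<and> (\<forall>i<n. h i = F i)"
    have "?Q F" using that by simp
    then obtain h where "?Q h" "\<And>h'. ?Q h' \<Longrightarrow> length (h n) \<le> length (h' n)"
      using ex_has_least_nat[of ?Q F "\<lambda>h. length (h n)"] by blast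
    then show ?thesis unfolding M_def by (intro exI[of _ h]) auto
  qed
  have "\<exists>F. \<forall>n. M n (F n) \<and> (\<forall>i<Suc n. F (Suc n) i = F n i)"
  proof (rule dependent_nat_choice)
    show "\<exists>x. M 0 x" using ex min by blast
    show "\<exists>y. M (Suc n) y \<and> (\<forall>i<Suc n. y i = x i)" if "M n x" for x n
      using that min[of x "Suc n"] unfolding M_def[of n] by blast
  qed
  then obtain F where F: "\<And>n. M n (F n)" "\<And>n i. i < Suc n \<Longrightarrow> F (Suc n) i = F n i" by blast
  define g where "g n = F n n" for n
  have agree: "F n i = g i" if "i \<le> n" for n i
    using that
  proof (induction n)
    case (Suc n)
    then show ?case using F(2)[of i n] by (cases "i = Suc n") (auto simp: g_def)
  qed (simp add: g_def)
  have bad_g: "\<not> list_emb P (g i) (g j)" if "i < j" for i j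
    using F(1)[of j] that agree[of i j] agree[of j j] unfolding M_def bad_def
    by (metis less_imp_le order_refl)
  have min_g: "length (g n) \<le> length (h n)" if "bad h" "\<And>i. i < n \<Longrightarrow> h i = g i" for h n
    using F(1)[of n] that agree[of _ n] unfolding M_def by (metis less_imp_le order_refl)
  have ne: "g n \<noteq> []" for n
    using bad_g[of n "Suc n"] by force
  define a w where "a n = hd (g n)" and "w n = tl (g n)" for n
  have g: "g n = a n # w n" for n using ne[of n] by (simp add: a_def w_def)
  obtain \<phi> :: "nat \<Rightarrow> nat" where \<phi>: "strict_mono \<phi>" "\<And>i j. i < j \<Longrightarrow> P (a (\<phi> i)) (a (\<phi> j))"
    using wqo_monotone_subseq[OF assms, of a] by blast
  \<comment> \<open>First letters are removed along \<open>\<phi>\<close>, where they increase. At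
    position \<open>\<phi> 0\<close> the result is shorter than \<open>g\<close>, so it is not bad,
    while each of its good pairs leads back to a good pair of \<open>g\<close>.\<close>
  define h where "h i = (if i < \<phi> 0 then g i else w (\<phi> (i - \<phi> 0)))" for i
  have "\<not> bad h"
  proof
    assume "bad h"
    then have "length (g (\<phi> 0)) \<le> length (h (\<phi> 0))" by (rule min_g) (simp add: h_def)
    then show False by (simp add: h_def g)
  qed
  then obtain i j where ij: "i < j" "list_emb P (h i) (h j)" unfolding bad_def by blast
  consider "j < \<phi> 0" | "i < \<phi> 0" "\<phi> 0 \<le> j" | "\<phi> 0 \<le> i" using ij by linarith
  then show False
  proof cases
    case 1
    then show ?thesis using ij bad_g[of i j] by (simp add: h_def)
  next
    case 2
    have "\<phi> 0 \<le> \<phi> (j - \<phi> 0)" using \<phi>(1) by (simp add: strict_mono_less_eq)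
    moreover have "list_emb P (g i) (g (\<phi> (j - \<phi> 0)))"
      using ij 2 by (subst (2) g) (auto simp: h_def)
    ultimately show ?thesis using bad_g[of i "\<phi> (j - \<phi> 0)"] 2 by linarith
  next
    case 3
    have lt: "i - \<phi> 0 < j - \<phi> 0" using 3 ij by linarith
    have "list_emb P (g (\<phi> (i - \<phi> 0))) (g (\<phi> (j - \<phi> 0)))"
      using ij 3 \<phi>(2)[OF lt] by (simp add: g h_def list_emb_Cons2)
    moreover have "\<phi> (i - \<phi> 0) < \<phi> (j - \<phi> 0)" using lt \<phi>(1) by (simp add: strict_mono_less)
    ultimately show ?thesis using bad_g by blast
  qed
qed

text \<open>\<open>f\<close> is strictly monotone on all of \<open>nat\<close>, beyond the length of
  \<open>xs\<close> as well, so that it can be turned into an element of \<open>Inc\<close>.\<close>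

lemma list_emb_strict_mono:
  assumes "list_emb P xs ys"
  shows "\<exists>f :: nat \<Rightarrow> nat. strict_mono f \<and>
    (\<forall>j<length xs. f j < length ys \<and> P (xs ! j) (ys ! f j))"
  using assms
proof induction
  case (list_emb_Nil ys)
  show ?case by (intro exI[of _ id]) (auto simp: strict_mono_def)
next
  case (list_emb_Cons xs ys y)
  then obtain f where "strict_mono f" "\<forall>j<length xs. f j < length ys \<and> P (xs ! j) (ys ! f j)"
    by blast
  then show ?case by (intro exI[of _ "\<lambda>j. Suc (f j)"]) (auto simp: strict_mono_def)
next
  case (list_emb_Cons2 x y xs ys)
  then obtain f where f: "strict_mono f" "\<forall>j<length xs. f j < length ys \<and> P (xs ! j) (ys ! f j)"
    by blast
  let ?h = "\<lambda>j. case j of 0 \<Rightarrow> 0 | Suc j \<Rightarrow> Suc (f j)"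
  show ?case
  proof (intro exI[of _ ?h] conjI allI impI)
    show "strict_mono ?h" using f(1) by (auto simp: strict_mono_def split: nat.splits)
    show "?h j < length (y # ys)" "P ((x # xs) ! j) ((y # ys) ! ?h j)"
      if "j < length (x # xs)" for j
      using f(2) that list_emb_Cons2 by (cases j; simp)+
  qed
qed

text \<open>Greedy choice: without a finite basis, for each finite subset of \<open>S\<close> some
  element of \<open>S\<close> lies above none of its members, and the elements chosen in this way
  form a bad sequence.\<close>

lemma wqo_finite_basis:
  assumes "wqo P"
  shows "\<exists>B. finite B \<and> B \<subseteq> S \<and> (\<forall>x\<in>S. \<exists>b\<in>B. P b x)"
proof (rule ccontr)
  assume no: "\<not> ?thesis"
  have "\<exists>x\<in>S. \<forall>b\<in>B. \<not> P b x" if B: "finite B" "B \<subseteq> S" for B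
  proof (rule ccontr)
    assume "\<not> ?thesis"
    with B have "finite B \<and> B \<subseteq> S \<and> (\<forall>x\<in>S. \<exists>b\<in>B. P b x)" by simp
    then show False by (rule notE[OF no exI])
  qed
  then obtain g where g: "\<And>B. finite B \<Longrightarrow> B \<subseteq> S \<Longrightarrow> g B \<in> S \<and> (\<forall>b\<in>B. \<not> P b (g B))" by metis
  define B where "B n = rec_nat {} (\<lambda>_ B. insert (g B) B) n" for n
  have Suc: "B (Suc n) = insert (g (B n)) (B n)" and zero: "B 0 = {}" for n by (simp_all add: B_def)
  have fin: "finite (B n) \<and> B n \<subseteq> S" for n
    by (induction n) (use g in \<open>auto simp: zero Suc\<close>)
  obtain i j where ij: "i < j" "P (g (B i)) (g (B j))"
    by (rule wqoE[OF assms(1), of "\<lambda>n. g (B n)"])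
  have "B (Suc i) \<subseteq> B j"
    by (rule lift_Suc_mono_le[of B]) (use ij(1) in \<open>auto simp: Suc\<close>)
  then show False using g[of "B j"] fin ij(2) by (auto simp: Suc)
qed

section \<open>Monomials and leading monomials\<close>

text \<open>Relabelling of keys, with coefficients added up where labels collide. It covers the
  action on monomials, the action on polynomials, multiplication by a monomial and, for the
  identity, the expansion of a polynomial into its terms.\<close>

definition map_mon :: "('a \<Rightarrow> 'b) \<Rightarrow> ('a \<Rightarrow>\<^sub>0 'c::comm_monoid_add) \<Rightarrow> 'b \<Rightarrow>\<^sub>0 'c" where
  "map_mon g f = (\<Sum>t\<in>Poly_Mapping.keys f. Poly_Mapping.single (g t) (Poly_Mapping.lookup f t))"

lemma keys_map_mon: "Poly_Mapping.keys (map_mon g f) \<subseteq> g ` Poly_Mapping.keys f"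
proof
  fix k assume k: "k \<in> Poly_Mapping.keys (map_mon g f)"
  show "k \<in> g ` Poly_Mapping.keys f"
  proof (rule ccontr)
    assume "k \<notin> g ` Poly_Mapping.keys f"
    then have "Poly_Mapping.lookup (map_mon g f) k = 0"
      unfolding map_mon_def lookup_sum
      by (intro sum.neutral) (auto simp: lookup_single when_def)
    with k show False by (simp add: in_keys_iff)
  qed
qed

lemma lookup_map_mon:
  assumes "inj_on g A" and "Poly_Mapping.keys f \<subseteq> A" and "t \<in> A"
  shows "Poly_Mapping.lookup (map_mon g f) (g t) = Poly_Mapping.lookup f t"
proof -
  have "Poly_Mapping.lookup (map_mon g f) (g t) =
      (\<Sum>s\<in>Poly_Mapping.keys f. if s = t then Poly_Mapping.lookup f s else 0)"
    unfolding map_mon_def lookup_sum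
    using assms by (intro sum.cong) (auto simp: lookup_single when_def dest: inj_onD)
  then show ?thesis by (simp add: in_keys_iff)
qed

lemma map_mon_id: "map_mon (\<lambda>t. t) f = f"
  by (intro poly_mapping_eqI) (rule lookup_map_mon[of "\<lambda>t. t" UNIV, simplified])

lemma times_single_one:
  fixes f :: "'a::comm_monoid_add \<Rightarrow>\<^sub>0 'k::comm_ring_1"
  shows "f * Poly_Mapping.single u 1 = map_mon (\<lambda>t. t + u) f"
  by (subst (1) map_mon_id[of f, symmetric]) (simp add: map_mon_def sum_distrib_right mult_single)

section \<open>The action of increasing maps on monomials\<close>

lemma act_mon_eq: "act_mon p t = map_mon (\<lambda>(i, j). (i, p j)) t"
  unfolding act_mon_def map_mon_def by (simp add: case_prod_unfold)

lemma act_eq: "act p f = map_mon (act_mon p) f"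
  by (simp add: act_def map_mon_def)

lemma monomials_mono: "A \<subseteq> B \<Longrightarrow> monomials c A \<subseteq> monomials c B"
  unfolding monomials_def by blast

lemma monomials_interval_subset: "monomials c {1..n} \<subseteq> monomials c {1..}"
  by (rule monomials_mono) auto

lemma zero_monomials [simp]: "0 \<in> monomials c A"
  by (simp add: monomials_def)

lemma monomials_dvd:
  assumes "t \<in> monomials c A" and "\<And>k. Poly_Mapping.lookup s k \<le> Poly_Mapping.lookup t k"
  shows "\<exists>u\<in>monomials c A. t = s + u"
proof
  show "t = s + (t - s)"
    using assms(2) by (intro poly_mapping_eqI) (simp add: lookup_add lookup_minus)
  have "Poly_Mapping.keys (t - s) \<subseteq> Poly_Mapping.keys t"
    by (auto simp: in_keys_iff lookup_minus)
  then show "t - s \<in> monomials c A" using assms(1) unfolding monomials_def by blast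
qed

lemma IncD:
  assumes "p \<in> Inc" and "j \<ge> 1"
  shows "p j \<ge> 1" and "j < k \<Longrightarrow> p j < p k"
  using assms unfolding Inc_def by (auto simp: strict_mono_on_def)

lemma Inc_mono:
  assumes "p \<in> Inc" and "j \<ge> 1" and "j \<le> k"
  shows "p j \<le> p k"
  using assms IncD(2)[of p j k] by (cases "j = k") auto

text \<open>Column 0 is left out because \<open>p 0\<close> is arbitrary and may collide with
  another value.\<close>

lemma inj_on_act_index:
  assumes "p \<in> Inc"
  shows "inj_on (\<lambda>(i, j). (i, p j)) (UNIV \<times> {1..})"
proof (rule inj_onI, clarsimp)
  fix j k :: nat
  assume "Suc 0 \<le> j" "Suc 0 \<le> k" "p j = p k"
  then show "j = k" using IncD(2)[OF assms, of j k] IncD(2)[OF assms, of k j]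
    by (cases j k rule: linorder_cases) auto
qed

lemma lookup_act_mon:
  assumes "p \<in> Inc" and "t \<in> monomials c {1..}" and "j \<ge> 1"
  shows "Poly_Mapping.lookup (act_mon p t) (i, p j) = Poly_Mapping.lookup t (i, j)"
  using lookup_map_mon[OF inj_on_act_index[OF assms(1)], of t "(i, j)"] assms
  unfolding act_mon_eq monomials_def by auto

lemma keys_act_mon:
  "Poly_Mapping.keys (act_mon p t) \<subseteq> (\<lambda>(i, j). (i, p j)) ` Poly_Mapping.keys t"
  unfolding act_mon_eq by (rule keys_map_mon)

lemma inj_on_act_mon:
  assumes "p \<in> Inc"
  shows "inj_on (act_mon p) (monomials c {1..})"
proof (rule inj_onI)
  fix s t
  assume st: "s \<in> monomials c {1..}" "t \<in> monomials c {1..}" "act_mon p s = act_mon p t"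
  show "s = t"
  proof (rule poly_mapping_eqI)
    fix k :: "nat \<times> nat"
    obtain i j where k: "k = (i, j)" by (cases k)
    show "Poly_Mapping.lookup s k = Poly_Mapping.lookup t k"
    proof (cases "j \<ge> 1")
      case True
      then show ?thesis
        using lookup_act_mon[OF assms st(1), of j i] lookup_act_mon[OF assms st(2), of j i] st(3) k
        by simp
    next
      case False
      then have "k \<notin> Poly_Mapping.keys s" "k \<notin> Poly_Mapping.keys t"
        using st k unfolding monomials_def by auto
      then show ?thesis by (simp add: in_keys_iff)
    qed
  qed
qed

lemma act_mon_cong:
  assumes "t \<in> monomials c A" and "\<And>j. j \<in> A \<Longrightarrow> p j = q j"
  shows "act_mon p t = act_mon q t"
  unfolding act_mon_def using assms by (intro sum.cong) (auto simp: monomials_def)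

lemma act_mon_comp:
  assumes "p \<in> Inc" and "q \<in> Inc" and "t \<in> monomials c {1..}"
  shows "act_mon q (act_mon p t) = act_mon (q \<circ> p) t"
proof (rule poly_mapping_eqI)
  fix k :: "nat \<times> nat"
  have pt: "act_mon p t \<in> monomials c {1..}"
    using keys_act_mon[of p t] assms(3) IncD(1)[OF assms(1)] unfolding monomials_def by fastforce
  have qp: "q \<circ> p \<in> Inc"
    using IncD[OF assms(1)] IncD[OF assms(2)] unfolding Inc_def by (auto simp: strict_mono_on_def)
  have sub: "Poly_Mapping.keys (act_mon q (act_mon p t)) \<union> Poly_Mapping.keys (act_mon (q \<circ> p) t)
      \<subseteq> (\<lambda>(i, j). (i, q (p j))) ` Poly_Mapping.keys t"
    using keys_act_mon[of q "act_mon p t"] keys_act_mon[of p t] keys_act_mon[of "q \<circ> p" t]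
    by fastforce
  show "Poly_Mapping.lookup (act_mon q (act_mon p t)) k = Poly_Mapping.lookup (act_mon (q \<circ> p) t) k"
  proof (cases "k \<in> (\<lambda>(i, j). (i, q (p j))) ` Poly_Mapping.keys t")
    case True
    then obtain i j where k: "k = (i, q (p j))" and "(i, j) \<in> Poly_Mapping.keys t" by auto
    then have j: "j \<ge> 1" using assms(3) unfolding monomials_def by auto
    show ?thesis
      using lookup_act_mon[OF assms(2) pt IncD(1)[OF assms(1) j]] lookup_act_mon[OF assms(1,3) j]
        lookup_act_mon[OF qp assms(3) j] k by simp
  next
    case False
    with sub have "k \<notin> Poly_Mapping.keys (act_mon q (act_mon p t))"
        "k \<notin> Poly_Mapping.keys (act_mon (q \<circ> p) t)" by blast+
    then show ?thesis by (simp add: in_keys_iff)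
  qed
qed

text \<open>The inner factor is the smaller of \<open>p\<close> and the shift by \<open>N - m\<close>, the largest embedding of \<open>{1..m}\<close>
  into \<open>{1..N}\<close>. The outer factor is the identity as long as \<open>p\<close> is the smaller one, and
  afterwards it undoes the shift and applies \<open>p\<close>.\<close>

lemma Inc_factor:
  assumes "p \<in> Inc" and "1 \<le> m" and "m \<le> N" and "N \<le> n" and "p m \<le> n"
  shows "\<exists>q'\<in>Inc_between m N. \<exists>q\<in>Inc_between N n. \<forall>j\<in>{1..m}. q (q' j) = p j"
proof -
  define a where "a = N - m"
  define q' where "q' j = min (p j) (a + j)" for j
  \<comment> \<open>For \<open>k \<le> a\<close> the difference \<open>k - a\<close> would be 0,
    where \<open>p\<close> is arbitrary; hence the case distinction. At \<open>k = N\<close> one has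
    \<open>N - a = m\<close>, so the value is the maximum of \<open>N\<close> and
    \<open>p m\<close>, which is at most \<open>n\<close>.\<close>
  define q where "q k = (if k \<le> a then k else max k (p (k - a)))" for k
  note p = IncD[OF assms(1)]
  have "q' \<in> Inc"
    using p unfolding Inc_def q'_def by (auto simp: strict_mono_on_def min_def)
      (metis add_strict_left_mono le_less_trans not_le order_less_trans)+
  moreover have "q \<in> Inc"
  proof -
    have "q k \<ge> 1" if "k \<ge> 1" for k using that by (simp add: q_def le_max_iff_disj)
    moreover have "q k < q l" if "1 \<le> k" "k < l" for k l
    proof (cases "k \<le> a")
      case False
      then have "p (k - a) < p (l - a)" using that by (intro p(2)) auto
      with False that show ?thesis by (auto simp: q_def less_max_iff_disj)
    qed (use that in \<open>auto simp: q_def less_max_iff_disj\<close>)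
    ultimately show ?thesis unfolding Inc_def by (auto simp: strict_mono_on_def)
  qed
  moreover have "q' m \<le> N" using assms(3) by (simp add: q'_def a_def)
  moreover have "q N \<le> n" using assms by (auto simp: q_def a_def)
  moreover have "q (q' j) = p j" if "j \<in> {1..m}" for j
  proof (cases "p j \<le> a + j")
    case True
    have "p (p j - a) \<le> p j" if "\<not> p j \<le> a"
      using that True Inc_mono[OF assms(1), of "p j - a" j] by simp
    then show ?thesis using True by (auto simp: q_def q'_def)
  next
    case False
    then show ?thesis using that by (auto simp: q_def q'_def)
  qed
  ultimately show ?thesis unfolding Inc_between_def by blast
qed

section \<open>Term orders and leading monomials\<close>

lemma term_orderD:
  assumes "term_order c r"
  shows "antisym r" and "trans r" and "r \<subseteq> monomials c {1..} \<times> monomials c {1..}"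
    and "t \<in> monomials c {1..} \<Longrightarrow> (t, t) \<in> r"
    and "s \<in> monomials c {1..} \<Longrightarrow> t \<in> monomials c {1..} \<Longrightarrow> (s, t) \<in> r \<or> (t, s) \<in> r"
    and "u \<in> monomials c {1..} \<Longrightarrow> (s, t) \<in> r \<Longrightarrow> (s + u, t + u) \<in> r"
    and "s \<in> monomials c {1..} \<Longrightarrow> u \<in> monomials c {1..} \<Longrightarrow> (s, s + u) \<in> r"
proof -
  note t = assms[unfolded term_order_def order_on_defs refl_on_def total_on_def]
  show "antisym r" "trans r" "r \<subseteq> monomials c {1..} \<times> monomials c {1..}"
    "t \<in> monomials c {1..} \<Longrightarrow> (t, t) \<in> r"
    and add: "\<And>s t u. u \<in> monomials c {1..} \<Longrightarrow> (s, t) \<in> r \<Longrightarrow> (s + u, t + u) \<in> r"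
    using t by blast+
  show "(s, t) \<in> r \<or> (t, s) \<in> r" if "s \<in> monomials c {1..}" "t \<in> monomials c {1..}"
    using t that by (cases "s = t") blast+
  show "(s, s + u) \<in> r" if "s \<in> monomials c {1..}" "u \<in> monomials c {1..}"
    using add[of s 0 u] t that by (simp add: add.commute)
qed

lemma lead_mon_eq:
  assumes "antisym r" and "t \<in> Poly_Mapping.keys f" and "\<And>s. s \<in> Poly_Mapping.keys f \<Longrightarrow> (s, t) \<in> r"
  shows "lead_mon r f = t"
  unfolding lead_mon_def using assms by (intro the_equality) (auto dest: antisymD)

lemma lead_mon_greatest:
  assumes "term_order c r" and "f \<noteq> 0" and "Poly_Mapping.keys f \<subseteq> monomials c {1..}"
  shows "lead_mon r f \<in> Poly_Mapping.keys f"
    and "s \<in> Poly_Mapping.keys f \<Longrightarrow> (s, lead_mon r f) \<in> r"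
proof -
  have "\<exists>t\<in>K. \<forall>s\<in>K. (s, t) \<in> r" if "finite K" "K \<noteq> {}" "K \<subseteq> monomials c {1..}" for K
    using that
  proof (induction K rule: finite_ne_induct)
    case (singleton x)
    then show ?case using term_orderD(4)[OF assms(1)] by blast
  next
    case (insert x K)
    then obtain t where t: "t \<in> K" "\<forall>s\<in>K. (s, t) \<in> r" by blast
    then consider "(x, t) \<in> r" | "(t, x) \<in> r"
      using term_orderD(5)[OF assms(1), of x t] insert.prems by blast
    then show ?case
    proof cases
      case 1
      with t show ?thesis by blast
    next
      case 2
      then have "\<forall>s\<in>insert x K. (s, x) \<in> r"
        using t term_orderD(2,4)[OF assms(1)] insert.prems by (auto dest: transD)
      then show ?thesis by blast
    qed
  qed
  then obtain t where "t \<in> Poly_Mapping.keys f" "\<forall>s\<in>Poly_Mapping.keys f. (s, t) \<in> r"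
    using assms(2,3) by (metis finite_keys keys_eq_empty)
  then show "lead_mon r f \<in> Poly_Mapping.keys f"
    and "s \<in> Poly_Mapping.keys f \<Longrightarrow> (s, lead_mon r f) \<in> r"
    using lead_mon_eq[OF term_orderD(1)[OF assms(1)], of t f] by auto
qed

text \<open>Injectivity excludes cancellation of the leading term. The general \<open>g\<close>
  serves both the action and multiplication by a monomial.\<close>

lemma lead_mon_map_mon:
  assumes "term_order c r" and "f \<noteq> 0" and "Poly_Mapping.keys f \<subseteq> monomials c {1..}"
    and "inj_on g (monomials c {1..})" and "\<And>s t. (s, t) \<in> r \<Longrightarrow> (g s, g t) \<in> r"
  shows "map_mon g f \<noteq> 0" and "lead_mon r (map_mon g f) = g (lead_mon r f)"
proof -
  note lead = lead_mon_greatest[OF assms(1-3)]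
  have "Poly_Mapping.lookup (map_mon g f) (g (lead_mon r f)) \<noteq> 0"
    using lookup_map_mon[OF assms(4,3), of "lead_mon r f"] lead(1) assms(3) by (auto simp: in_keys_iff)
  then have key: "g (lead_mon r f) \<in> Poly_Mapping.keys (map_mon g f)" by (simp add: in_keys_iff)
  then show "map_mon g f \<noteq> 0" by auto
  show "lead_mon r (map_mon g f) = g (lead_mon r f)"
  proof (rule lead_mon_eq[OF term_orderD(1)[OF assms(1)] key])
    fix s assume "s \<in> Poly_Mapping.keys (map_mon g f)"
    then obtain s' where "s' \<in> Poly_Mapping.keys f" "s = g s'" using keys_map_mon[of g f] by blast
    then show "(s, g (lead_mon r f)) \<in> r" using lead(2) assms(5) by blast
  qed
qed

text \<open>By Dickson's lemma an infinite descent in finitely many variables contains some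
  \<open>f i\<close> dividing a later \<open>f j\<close>, and a term order refines divisibility. The
  bound \<open>n\<close> matters: over all columns, a lexicographic order with
  \<open>x(1,1) > x(1,2) > ...\<close> descends forever.\<close>

lemma wf_term_order:
  assumes "term_order c r"
  shows "wf ((r - Id) \<inter> monomials c {1..n} \<times> monomials c {1..n})"
proof (rule ccontr)
  assume "\<not> ?thesis"
  then obtain f where "\<And>i. (f (Suc i), f i) \<in> (r - Id) \<inter> monomials c {1..n} \<times> monomials c {1..n}"
    unfolding wf_iff_no_infinite_down_chain by blast
  then have f: "(f (Suc i), f i) \<in> r" "f (Suc i) \<noteq> f i" "f i \<in> monomials c {1..n}" for i
    by auto
  note r = term_orderD[OF assms]
  have desc: "(f j, f i) \<in> r \<and> f j \<noteq> f i" if "i < j" for i j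
    using that
  proof (induction j)
    case (Suc j)
    show ?case
    proof (cases "i = j")
      case False
      then have "(f j, f i) \<in> r" "f j \<noteq> f i" using Suc by auto
      then show ?thesis using f(1,2)[of j] r(1,2) by (metis antisymD transD)
    qed (use f in auto)
  qed simp
  obtain i j where ij: "i < j" and le: "\<forall>k\<in>{1..c} \<times> {1..n}.
      Poly_Mapping.lookup (f i) k \<le> Poly_Mapping.lookup (f j) k"
    by (rule wqoE[OF wqo_pointwise, of "{1..c} \<times> {1..n}" "\<lambda>i. Poly_Mapping.lookup (f i)"]) auto
  have "Poly_Mapping.lookup (f i) k \<le> Poly_Mapping.lookup (f j) k" for k
  proof (cases "k \<in> {1..c} \<times> {1..n}")
    case False
    then have "k \<notin> Poly_Mapping.keys (f i)" using f(3)[of i] unfolding monomials_def by blast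
    then show ?thesis by (simp add: in_keys_iff)
  qed (use le in blast)
  then obtain u where "u \<in> monomials c {1..n}" and eq: "f j = f i + u"
    using monomials_dvd f(3) by blast
  then have "(f i, f j) \<in> r"
    using r(7) f(3)[of i] monomials_interval_subset unfolding eq by blast
  then show False using desc[OF ij] r(1) by (auto dest: antisymD)
qed

section \<open>Leading monomials of ideals and the initial chain\<close>

text \<open>These are the monomials of the initial ideal: the set is closed under multiplication by
  monomials (\<open>leads_add\<close>), so it determines that ideal and replaces it below
  (\<open>initial_chain_eq\<close>).\<close>

definition leads :: "mon rel \<Rightarrow> 'k::field mpoly set \<Rightarrow> mon set" where
  "leads r I = {lead_mon r f | f. f \<in> I \<and> f \<noteq> 0}"

lemma poly_ring_idealD:
  assumes "ideal I (poly_ring c n)"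
  shows "f \<in> I \<Longrightarrow> Poly_Mapping.keys f \<subseteq> monomials c {1..n}"
    and "0 \<in> I" and "f \<in> I \<Longrightarrow> g \<in> I \<Longrightarrow> f + g \<in> I"
    and "f \<in> I \<Longrightarrow> Poly_Mapping.keys g \<subseteq> monomials c {1..n} \<Longrightarrow> f * g \<in> I"
proof -
  interpret ideal I "poly_ring c n" by fact
  show "f \<in> I \<Longrightarrow> Poly_Mapping.keys f \<subseteq> monomials c {1..n}" "0 \<in> I"
      "f \<in> I \<Longrightarrow> g \<in> I \<Longrightarrow> f + g \<in> I"
      "f \<in> I \<Longrightarrow> Poly_Mapping.keys g \<subseteq> monomials c {1..n} \<Longrightarrow> f * g \<in> I"
    using a_Hcarr[of f] additive_subgroup.zero_closed[OF is_additive_subgroup]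
      additive_subgroup.a_closed[OF is_additive_subgroup, of f g] I_r_closed[of f g]
    unfolding poly_ring_def by auto
qed

lemma poly_ring_ideal_sum:
  assumes "ideal I (poly_ring c n)" and "\<And>x. x \<in> A \<Longrightarrow> f x \<in> I"
  shows "sum f A \<in> I"
  using assms(2) poly_ring_idealD(2,3)[OF assms(1)]
  by (induction A rule: infinite_finite_induct) auto

lemma leads_monomials:
  assumes "ideal I (poly_ring c n)" and "term_order c r"
  shows "leads r I \<subseteq> monomials c {1..n}"
proof
  fix t assume "t \<in> leads r I"
  then obtain f where f: "f \<in> I" "f \<noteq> 0" "t = lead_mon r f" unfolding leads_def by blast
  then show "t \<in> monomials c {1..n}"
    using poly_ring_idealD(1)[OF assms(1)] lead_mon_greatest(1)[OF assms(2), of f] monomials_interval_subset by blast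
qed

lemma leads_add:
  assumes "ideal I (poly_ring c n)" and "term_order c r"
    and "t \<in> leads r I" and "u \<in> monomials c {1..n}"
  shows "t + u \<in> leads r I"
proof -
  obtain f where f: "f \<in> I" "f \<noteq> 0" "t = lead_mon r f" using assms(3) unfolding leads_def by blast
  have "Poly_Mapping.keys f \<subseteq> monomials c {1..}"
    using poly_ring_idealD(1)[OF assms(1) f(1)] monomials_interval_subset by blast
  moreover have "u \<in> monomials c {1..}" using assms(4) monomials_interval_subset by blast
  ultimately have "map_mon (\<lambda>t. t + u) f \<noteq> 0" "lead_mon r (map_mon (\<lambda>t. t + u) f) = t + u"
    using lead_mon_map_mon[OF assms(2) f(2), of "\<lambda>t. t + u"] term_orderD(6)[OF assms(2)] f(3)
    by (auto simp: inj_on_def)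
  moreover have "map_mon (\<lambda>t. t + u) f \<in> I"
    unfolding times_single_one[symmetric]
    using poly_ring_idealD(4)[OF assms(1) f(1)] assms(4) by simp
  ultimately show ?thesis unfolding leads_def by force
qed

text \<open>The ring laws of \<open>poly_ring\<close> are a hypothesis because they come with the
  ideals of the chain.\<close>

lemma ideal_keys_subset:
  assumes "ring (poly_ring c n :: 'k::field mpoly ring)" and "T \<subseteq> monomials c {1..n}"
    and add: "\<And>t u. t \<in> T \<Longrightarrow> u \<in> monomials c {1..n} \<Longrightarrow> t + u \<in> T"
  shows "ideal {f. Poly_Mapping.keys f \<subseteq> T} (poly_ring c n :: 'k mpoly ring)"
proof (rule idealI[OF assms(1)])
  interpret ring "poly_ring c n :: 'k mpoly ring" by fact
  let ?R = "poly_ring c n :: 'k mpoly ring"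
  let ?I = "{f :: 'k mpoly. Poly_Mapping.keys f \<subseteq> T}"
  have sub: "?I \<subseteq> carrier ?R" using assms(2) by (auto simp: poly_ring_def)
  have neg: "\<ominus>\<^bsub>?R\<^esub> f = - f" if "f \<in> ?I" for f
  proof (rule minus_equality)
    show "- f \<oplus>\<^bsub>?R\<^esub> f = \<zero>\<^bsub>?R\<^esub>" by (simp add: poly_ring_def)
    show "f \<in> carrier ?R" "- f \<in> carrier ?R" using that sub by (auto simp: poly_ring_def)
  qed
  show "subgroup ?I (add_monoid ?R)"
  proof (rule subgroup.intro)
    show "x \<otimes>\<^bsub>add_monoid ?R\<^esub> y \<in> ?I" if "x \<in> ?I" "y \<in> ?I" for x y
      using that keys_add[of x y] by (auto simp: poly_ring_def)
    show "inv\<^bsub>add_monoid ?R\<^esub> x \<in> ?I" if "x \<in> ?I" for x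
      using neg[OF that] that unfolding a_inv_def by simp
  qed (use sub in \<open>auto simp: poly_ring_def\<close>)
  show "a \<otimes>\<^bsub>?R\<^esub> x \<in> ?I" if "a \<in> ?I" "x \<in> carrier ?R" for a x
    using that keys_mult[of a x] add by (fastforce simp: poly_ring_def)
  then show "x \<otimes>\<^bsub>?R\<^esub> a \<in> ?I" if "a \<in> ?I" "x \<in> carrier ?R" for a x
    using that by (simp add: poly_ring_def mult.commute)
qed

text \<open>\<open>S\<close> may contain polynomials with several terms, as \<open>act_set\<close>
  produces them. It suffices that all are supported on \<open>T\<close> and that each element of
  \<open>T\<close> is a multiple of a monomial in \<open>S\<close>.\<close>

lemma genideal_monomial:
  fixes S :: "'k::field mpoly set"
  assumes "ring (poly_ring c n :: 'k mpoly ring)" and T: "T \<subseteq> monomials c {1..n}"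
    and add: "\<And>t u. t \<in> T \<Longrightarrow> u \<in> monomials c {1..n} \<Longrightarrow> t + u \<in> T"
    and S: "\<And>f. f \<in> S \<Longrightarrow> Poly_Mapping.keys f \<subseteq> T"
    and gen: "\<And>t. t \<in> T \<Longrightarrow> \<exists>s u. Poly_Mapping.single s 1 \<in> S \<and> u \<in> monomials c {1..n} \<and> t = s + u"
  shows "genideal (poly_ring c n) S = {f. Poly_Mapping.keys f \<subseteq> T}"
proof
  interpret ring "poly_ring c n :: 'k mpoly ring" by fact
  show "genideal (poly_ring c n) S \<subseteq> {f. Poly_Mapping.keys f \<subseteq> T}"
    by (rule genideal_minimal[OF ideal_keys_subset[OF assms(1) T add]]) (use S in auto)
  have S': "S \<subseteq> carrier (poly_ring c n)" using S T unfolding poly_ring_def by fastforce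
  note I = genideal_ideal[OF S']
  show "{f. Poly_Mapping.keys f \<subseteq> T} \<subseteq> genideal (poly_ring c n) S"
  proof
    fix f :: "'k mpoly"
    assume f: "f \<in> {f. Poly_Mapping.keys f \<subseteq> T}"
    have "Poly_Mapping.single t (Poly_Mapping.lookup f t) \<in> genideal (poly_ring c n) S"
      if "t \<in> Poly_Mapping.keys f" for t
    proof -
      have "t \<in> T" using that f by blast
      then obtain s u where su: "Poly_Mapping.single s 1 \<in> S" "u \<in> monomials c {1..n}" "t = s + u"
        using gen by blast
      have "Poly_Mapping.single s 1 * Poly_Mapping.single u (Poly_Mapping.lookup f t)
          \<in> genideal (poly_ring c n) S"
        by (rule poly_ring_idealD(4)[OF I]) (use su genideal_self[OF S'] in auto)
      then show ?thesis by (simp add: mult_single su(3))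
    qed
    then have "map_mon (\<lambda>t. t) f \<in> genideal (poly_ring c n) S"
      unfolding map_mon_def by (intro poly_ring_ideal_sum[OF I])
    then show "f \<in> genideal (poly_ring c n) S" by (simp add: map_mon_id)
  qed
qed

text \<open>Compatibility enters here: \<open>act p\<close> carries the leading monomial of a
  polynomial to that of its image.\<close>

lemma leads_act_mon:
  assumes J: "Inc_invariant_chain c J" and r: "term_order c r" "Inc_compatible r"
    and mn: "1 \<le> m" "m \<le> n" and p: "p \<in> Inc_between m n" and t: "t \<in> leads r (J m)"
  shows "act_mon p t \<in> leads r (J n)"
proof -
  obtain f where f: "f \<in> J m" "f \<noteq> 0" "t = lead_mon r f" using t unfolding leads_def by blast
  have "ideal (J m) (poly_ring c m)" using J mn unfolding Inc_invariant_chain_def by simp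
  then have keys: "Poly_Mapping.keys f \<subseteq> monomials c {1..}"
    using poly_ring_idealD(1) f(1) monomials_interval_subset by blast
  have Inc: "p \<in> Inc" using p unfolding Inc_between_def by simp
  have "act p f \<noteq> 0" "lead_mon r (act p f) = act_mon p t"
    unfolding act_eq f(3)
    using lead_mon_map_mon[OF r(1) f(2) keys inj_on_act_mon[OF Inc]] r(2) Inc
    unfolding Inc_compatible_def by auto
  moreover have "act_set (Inc_between m n) (J m) \<subseteq> J n"
    using J mn unfolding Inc_invariant_chain_def by blast
  then have "act p f \<in> J n" using p f(1) unfolding act_set_def by blast
  ultimately show ?thesis unfolding leads_def by force
qed

lemma initial_chain_eq:
  fixes J :: "nat \<Rightarrow> 'k::field mpoly set"
  assumes "ideal (J n) (poly_ring c n)" and "term_order c r"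
  shows "initial_chain c r J n = {f. Poly_Mapping.keys f \<subseteq> leads r (J n)}"
  unfolding initial_chain_def
proof (rule genideal_monomial)
  show "ring (poly_ring c n :: 'k mpoly ring)" using assms(1) by (simp add: ideal_def)
  show "leads r (J n) \<subseteq> monomials c {1..n}" by (rule leads_monomials[OF assms])
  show "t + u \<in> leads r (J n)" if "t \<in> leads r (J n)" "u \<in> monomials c {1..n}" for t u
    by (rule leads_add[OF assms that])
  let ?S = "{Poly_Mapping.single (lead_mon r f) (1::'k) | f. f \<in> J n \<and> f \<noteq> 0}"
  show "Poly_Mapping.keys f \<subseteq> leads r (J n)" if "f \<in> ?S" for f
    using that unfolding leads_def by auto
  show "\<exists>s u. Poly_Mapping.single s 1 \<in> ?S \<and> u \<in> monomials c {1..n} \<and> t = s + u"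
    if "t \<in> leads r (J n)" for t
    using that unfolding leads_def by (intro exI[of _ t] exI[of _ 0]) auto
qed

text \<open>Translates stability of the initial chain into divisibility of monomials up to the
  action. \<open>N\<close> then belongs to the set whose least element is the index, hence bounds
  it.\<close>

lemma stability_index_initial_chain_le:
  fixes J :: "nat \<Rightarrow> 'k::field mpoly set"
  assumes J: "Inc_invariant_chain c J" and r: "term_order c r" "Inc_compatible r" and "N \<ge> 1"
    and gen: "\<And>n t. n \<ge> N \<Longrightarrow> t \<in> leads r (J n) \<Longrightarrow>
      \<exists>s\<in>leads r (J N). \<exists>p\<in>Inc_between N n. \<exists>u\<in>monomials c {1..n}. t = act_mon p s + u"
  shows "stability_index c (initial_chain c r J) \<le> N"
proof -
  have id: "ideal (J n) (poly_ring c n)" if "n \<ge> 1" for n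
    using J that unfolding Inc_invariant_chain_def by blast
  have "genideal (poly_ring c n) (act_set (Inc_between N n) (initial_chain c r J N)) =
      initial_chain c r J n" if "n \<ge> N" for n
  proof -
    let ?S = "act_set (Inc_between N n) {f :: 'k mpoly. Poly_Mapping.keys f \<subseteq> leads r (J N)}"
    have idn: "ideal (J n) (poly_ring c n)" using id that \<open>N \<ge> 1\<close> by simp
    have "genideal (poly_ring c n) ?S = {f. Poly_Mapping.keys f \<subseteq> leads r (J n)}"
    proof (rule genideal_monomial)
      show "ring (poly_ring c n :: 'k mpoly ring)" using idn by (simp add: ideal_def)
      show "leads r (J n) \<subseteq> monomials c {1..n}" by (rule leads_monomials[OF idn r(1)])
      show "t + u \<in> leads r (J n)" if "t \<in> leads r (J n)" "u \<in> monomials c {1..n}" for t u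
        by (rule leads_add[OF idn r(1) that])
      show "Poly_Mapping.keys f \<subseteq> leads r (J n)" if f: "f \<in> ?S" for f
      proof -
        obtain p f' where p: "p \<in> Inc_between N n" "Poly_Mapping.keys f' \<subseteq> leads r (J N)" "f = act p f'"
          using f unfolding act_set_def by blast
        then show ?thesis
          using keys_map_mon[of "act_mon p" f'] leads_act_mon[OF J r \<open>N \<ge> 1\<close> \<open>n \<ge> N\<close> p(1)]
          unfolding act_eq by blast
      qed
      show "\<exists>s u. Poly_Mapping.single s 1 \<in> ?S \<and> u \<in> monomials c {1..n} \<and> t = s + u"
        if t: "t \<in> leads r (J n)" for t
      proof -
        obtain s p u where s: "s \<in> leads r (J N)" "p \<in> Inc_between N n" "u \<in> monomials c {1..n}"
            "t = act_mon p s + u"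
          using gen[OF \<open>n \<ge> N\<close> t] by blast
        have "act p (Poly_Mapping.single s 1) = Poly_Mapping.single (act_mon p s) (1 :: 'k)"
          by (simp add: act_def)
        moreover have "act p (Poly_Mapping.single s (1 :: 'k)) \<in> ?S"
          using s unfolding act_set_def by (intro CollectI exI conjI) (auto intro: refl)
        ultimately show ?thesis using s by auto
      qed
    qed
    then show ?thesis
      using initial_chain_eq[of J N, OF id r(1)] initial_chain_eq[of J n, OF id r(1)] that \<open>N \<ge> 1\<close>
      by simp
  qed
  then show ?thesis
    unfolding stability_index_def using \<open>N \<ge> 1\<close> by (intro Least_le) blast
qed

section \<open>Normal forms and the comparison of two term orders\<close>

lemma lookup_times_const:
  fixes f :: "'a::comm_monoid_add \<Rightarrow>\<^sub>0 'k::comm_ring_1"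
  shows "Poly_Mapping.lookup (f * Poly_Mapping.single 0 b) t = Poly_Mapping.lookup f t * b"
proof -
  have "f * Poly_Mapping.single 0 b =
      (\<Sum>s\<in>Poly_Mapping.keys f. Poly_Mapping.single s (Poly_Mapping.lookup f s * b))"
    by (subst (1) map_mon_id[of f, symmetric]) (simp add: map_mon_def sum_distrib_right mult_single)
  also have "Poly_Mapping.lookup \<dots> t =
      (\<Sum>s\<in>Poly_Mapping.keys f. if s = t then Poly_Mapping.lookup f s * b else 0)"
    unfolding lookup_sum by (intro sum.cong) (auto simp: lookup_single when_def)
  also have "\<dots> = Poly_Mapping.lookup f t * b" by (simp add: in_keys_iff)
  finally show ?thesis .
qed

text \<open>Division with remainder, by induction along the term order. A term in
  \<open>leads r I\<close> is cancelled by a multiple of some \<open>g\<close>, and the smaller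
  terms that appear are reduced separately and added up; \<open>a\<close> varies because their
  coefficients are not known in advance.\<close>

lemma normal_form_exists:
  fixes I :: "'k::field mpoly set"
  assumes I: "ideal I (poly_ring c n)" and r: "term_order c r" and "t \<in> monomials c {1..n}"
  shows "\<exists>h\<in>I. Poly_Mapping.keys (Poly_Mapping.single t a - h) \<inter> leads r I = {}"
  using wf_term_order[OF r, of n] assms(3)
proof (induction t arbitrary: a rule: wf_induct_rule)
  case (less t)
  show ?case
  proof (cases "t \<in> leads r I")
    case False
    then show ?thesis using poly_ring_idealD(2)[OF I] by (intro bexI[of _ 0]) auto
  next
    case True
    then obtain g where g: "g \<in> I" "g \<noteq> 0" "t = lead_mon r g" unfolding leads_def by blast
    have kg: "Poly_Mapping.keys g \<subseteq> monomials c {1..n}" by (rule poly_ring_idealD(1)[OF I g(1)])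
    then have "Poly_Mapping.keys g \<subseteq> monomials c {1..}" using monomials_interval_subset by blast
    note lead = lead_mon_greatest[OF r g(2) this, folded g(3)]
    define b where "b = a / Poly_Mapping.lookup g t"
    define g' where "g' = g * Poly_Mapping.single 0 b"
    define k where "k = Poly_Mapping.single t a - g'"
    have g'I: "g' \<in> I" unfolding g'_def by (rule poly_ring_idealD(4)[OF I g(1)]) simp
    have "\<exists>h\<in>I. Poly_Mapping.keys (Poly_Mapping.single s (Poly_Mapping.lookup k s) - h) \<inter> leads r I = {}"
      if s: "s \<in> Poly_Mapping.keys k" for s
    proof (rule less.IH)
      have "Poly_Mapping.lookup k t = 0"
        using lead(1) by (simp add: k_def g'_def lookup_minus lookup_times_const b_def in_keys_iff)
      then have "s \<noteq> t" using s by (auto simp: in_keys_iff)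
      moreover from this have "s \<in> Poly_Mapping.keys g"
        using s by (auto simp: in_keys_iff k_def g'_def lookup_minus lookup_times_const lookup_single)
      ultimately show "(s, t) \<in> (r - Id) \<inter> monomials c {1..n} \<times> monomials c {1..n}"
          "s \<in> monomials c {1..n}"
        using lead kg less.prems by auto
    qed
    then obtain H where H: "\<And>s. s \<in> Poly_Mapping.keys k \<Longrightarrow> H s \<in> I"
      "\<And>s. s \<in> Poly_Mapping.keys k \<Longrightarrow>
        Poly_Mapping.keys (Poly_Mapping.single s (Poly_Mapping.lookup k s) - H s) \<inter> leads r I = {}"
      by metis
    define h where "h = g' + sum H (Poly_Mapping.keys k)"
    have hI: "h \<in> I" unfolding h_def
      using poly_ring_idealD(3)[OF I g'I] poly_ring_ideal_sum[OF I] H(1) by blast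
    have "Poly_Mapping.single t a - h =
        (\<Sum>s\<in>Poly_Mapping.keys k. Poly_Mapping.single s (Poly_Mapping.lookup k s) - H s)"
    proof -
      have "Poly_Mapping.single t a - h = map_mon (\<lambda>t. t) k - sum H (Poly_Mapping.keys k)"
        unfolding map_mon_id h_def k_def by simp
      then show ?thesis by (simp add: map_mon_def sum_subtractf)
    qed
    moreover have "Poly_Mapping.lookup
        (Poly_Mapping.single s (Poly_Mapping.lookup k s) - H s) x = 0"
      if "s \<in> Poly_Mapping.keys k" "x \<in> leads r I" for s x
      using H(2)[OF that(1)] that(2) unfolding not_in_keys_iff_lookup_eq_zero[symmetric] by blast
    ultimately have "Poly_Mapping.lookup (Poly_Mapping.single t a - h) x = 0"
      if "x \<in> leads r I" for x
      using that by (simp add: lookup_sum)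
    then have "Poly_Mapping.keys (Poly_Mapping.single t a - h) \<inter> leads r I = {}"
      by (auto simp: in_keys_iff)
    with hI show ?thesis by blast
  qed
qed

text \<open>The standard monomials of either order form a basis of the quotient by \<open>I\<close>, so neither set of
  standard monomials can be properly contained in the other.\<close>

lemma leads_antimono_eq:
  fixes I :: "'k::field mpoly set"
  assumes I: "ideal I (poly_ring c n)" and r: "term_order c r" and r': "term_order c r'"
    and sub: "leads r I \<subseteq> leads r' I"
  shows "leads r I = leads r' I"
proof (rule ccontr)
  assume "leads r I \<noteq> leads r' I"
  then obtain t where t: "t \<in> leads r' I" "t \<notin> leads r I" using sub by blast
  then have "t \<in> monomials c {1..n}" using leads_monomials[OF I r'] by blast
  then obtain h where h: "h \<in> I"
      "Poly_Mapping.keys (Poly_Mapping.single t 1 - h) \<inter> leads r' I = {}"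
    using normal_form_exists[OF I r', of t 1] by blast
  have "h \<noteq> 0" using h(2) t(1) by auto
  have "Poly_Mapping.keys h \<subseteq> monomials c {1..}"
    using poly_ring_idealD(1)[OF I h(1)] monomials_interval_subset by blast
  note lead = lead_mon_greatest(1)[OF r \<open>h \<noteq> 0\<close> this]
  \<comment> \<open>Apart from \<open>t\<close>, the monomials of \<open>h\<close> avoid
    \<open>leads r' I\<close> and so \<open>leads r I\<close>. The \<open>r\<close>-leading monomial
    of \<open>h\<close> could then only be \<open>t\<close>, which is not in
    \<open>leads r I\<close>.\<close>
  have L: "lead_mon r h \<in> leads r I" using h(1) \<open>h \<noteq> 0\<close> unfolding leads_def by blast
  then have "lead_mon r h \<noteq> t" using t(2) by blast
  then have "lead_mon r h \<in> Poly_Mapping.keys (Poly_Mapping.single t 1 - h)"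
    using lead by (auto simp: in_keys_iff lookup_minus lookup_single)
  then show False using h(2) L sub by blast
qed

section \<open>Finite generation of leading monomials up to the action\<close>

text \<open>Letters are the columns of exponents, compared later only on the rows
  \<open>{1..c}\<close>. The width \<open>n\<close> is part of the data, as trailing zero columns
  must be counted to obtain \<open>p m \<le> n\<close>; \<open>Suc\<close> turns list positions into
  columns from 1.\<close>

definition exponent_word :: "nat \<times> mon \<Rightarrow> (nat \<Rightarrow> nat) list" where
  "exponent_word = (\<lambda>(n, t). map (\<lambda>j i. Poly_Mapping.lookup t (i, Suc j)) [0..<n])"

text \<open>The positions chosen by the embedding give \<open>p\<close>, and the comparison of
  letters says that the image of \<open>s\<close> divides \<open>t\<close>. The last letter of the
  first word lands inside the second, so \<open>p m \<le> n\<close>.\<close>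

lemma list_emb_exponent_word:
  assumes emb: "list_emb (\<lambda>u v. \<forall>i\<in>{1..c}. u i \<le> v i) (exponent_word (m, s)) (exponent_word (n, t))"
    and "m \<ge> 1" and s: "s \<in> monomials c {1..m}" and t: "t \<in> monomials c {1..n}"
  shows "\<exists>p\<in>Inc_between m n. \<exists>u\<in>monomials c {1..n}. t = act_mon p s + u"
proof -
  obtain f where f: "strict_mono f" and le: "\<And>j. j < m \<Longrightarrow> f j < n \<and>
      (\<forall>i\<in>{1..c}. Poly_Mapping.lookup s (i, Suc j) \<le> Poly_Mapping.lookup t (i, Suc (f j)))"
  proof -
    obtain f where "strict_mono f" and f: "\<forall>j<m. f j < n \<and> (\<forall>i\<in>{1..c}.
        (exponent_word (m, s) ! j) i \<le> (exponent_word (n, t) ! f j) i)"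
      using list_emb_strict_mono[OF emb] by (auto simp: exponent_word_def)
    have nth: "exponent_word (n, t) ! j = (\<lambda>i. Poly_Mapping.lookup t (i, Suc j))" if "j < n" for n t j
      using that by (simp add: exponent_word_def)
    show thesis
    proof (rule that[OF \<open>strict_mono f\<close>])
      fix j assume "j < m"
      with f have "f j < n" "\<forall>i\<in>{1..c}. (exponent_word (m, s) ! j) i \<le> (exponent_word (n, t) ! f j) i"
        by blast+
      then show "f j < n \<and> (\<forall>i\<in>{1..c}.
          Poly_Mapping.lookup s (i, Suc j) \<le> Poly_Mapping.lookup t (i, Suc (f j)))"
        using \<open>j < m\<close> by (simp add: nth)
    qed
  qed
  define p where "p j = Suc (f (j - 1))" for j
  have Inc: "p \<in> Inc"
    using f unfolding Inc_def p_def by (auto simp: strict_mono_on_def strict_mono_def)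
  have "p m \<le> n" using le[of "m - 1"] \<open>m \<ge> 1\<close> by (auto simp: p_def)
  with Inc have "p \<in> Inc_between m n" by (simp add: Inc_between_def)
  moreover have "Poly_Mapping.lookup (act_mon p s) k \<le> Poly_Mapping.lookup t k" for k
  proof (cases "k \<in> Poly_Mapping.keys (act_mon p s)")
    case True
    then obtain i j where k: "k = (i, p j)" and "(i, j) \<in> Poly_Mapping.keys s"
      using keys_act_mon[of p s] by auto
    then have ij: "i \<in> {1..c}" "j \<in> {1..m}" using s unfolding monomials_def by auto
    have "s \<in> monomials c {1..}" using s monomials_interval_subset by blast
    then have "Poly_Mapping.lookup (act_mon p s) k = Poly_Mapping.lookup s (i, j)"
      unfolding k by (rule lookup_act_mon[OF Inc]) (use ij in simp)
    also have "Poly_Mapping.lookup s (i, j) \<le> Poly_Mapping.lookup t (i, p j)"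
    proof -
      have "j - 1 < m" using ij by auto
      then show ?thesis using le[of "j - 1"] ij by (simp add: p_def)
    qed
    finally show ?thesis by (simp add: k)
  qed (simp add: in_keys_iff)
  ultimately show ?thesis using monomials_dvd[OF t] by blast
qed

text \<open>Higman's lemma, applied to all levels together. Basis elements carry their level
  \<open>m\<close>, which decides the admissible maps \<open>Inc_between m n\<close>.\<close>

lemma monomials_finite_basis:
  assumes L: "\<And>n. n \<ge> 1 \<Longrightarrow> L n \<subseteq> monomials c {1..n}"
  shows "\<exists>B. finite B \<and> B \<subseteq> {(m, s). m \<ge> 1 \<and> s \<in> L m} \<and>
    (\<forall>n\<ge>1. \<forall>t\<in>L n.
      \<exists>(m, s)\<in>B. \<exists>p\<in>Inc_between m n. \<exists>u\<in>monomials c {1..n}. t = act_mon p s + u)"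
proof -
  let ?Q = "\<lambda>u v :: nat \<Rightarrow> nat. \<forall>i\<in>{1..c}. u i \<le> v i"
  let ?S = "{(m, s). m \<ge> 1 \<and> s \<in> L m}"
  have "wqo (list_emb ?Q)"
    by (intro wqo_list_emb wqo_pointwise) (auto simp: transp_def intro: order_trans)
  then have "wqo (\<lambda>x y. list_emb ?Q (exponent_word x) (exponent_word y))"
    by (rule wqo_vimage)
  from wqo_finite_basis[OF this, of ?S] obtain B where B: "finite B" "B \<subseteq> ?S"
      "\<forall>x\<in>?S. \<exists>b\<in>B. list_emb ?Q (exponent_word b) (exponent_word x)"
    by (elim exE conjE)
  show ?thesis
  proof (intro exI[of _ B] conjI B(1,2) allI impI ballI)
    fix n t
    assume nt: "n \<ge> 1" "t \<in> L n"
    then obtain m s where ms: "(m, s) \<in> B"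
        "list_emb ?Q (exponent_word (m, s)) (exponent_word (n, t))"
      using B(3) by fastforce
    then have "m \<ge> 1" "s \<in> L m" using B(2) by auto
    then have "\<exists>p\<in>Inc_between m n. \<exists>u\<in>monomials c {1..n}. t = act_mon p s + u"
      using list_emb_exponent_word[OF ms(2)] L nt by blast
    with ms(1) show "\<exists>(m, s)\<in>B. \<exists>p\<in>Inc_between m n. \<exists>u\<in>monomials c {1..n}. t = act_mon p s + u"
      by blast
  qed
qed

text \<open>Agreement puts each generator \<open>lead_mon r f\<close> into
  \<open>leads r' (J m)\<close>. Invariance spreads this to
  \<open>leads r (J n) \<subseteq> leads r' (J n)\<close> for \<open>n \<ge> N\<close>, and
  \<open>leads_antimono_eq\<close> gives equality, so what generates for \<open>r\<close> also
  generates for \<open>r'\<close>.\<close>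

lemma stability_index_le_of_agree:
  fixes J :: "nat \<Rightarrow> 'k::field mpoly set"
  assumes J: "Inc_invariant_chain c J" and r: "term_order c r" "Inc_compatible r"
    and r': "term_order c r'" "Inc_compatible r'"
    and F: "\<And>m f. (m, f) \<in> F \<Longrightarrow>
      1 \<le> m \<and> m \<le> N \<and> f \<in> J m \<and> f \<noteq> 0 \<and> lead_mon r' f = lead_mon r f"
    and gen: "\<And>n t. n \<ge> 1 \<Longrightarrow> t \<in> leads r (J n) \<Longrightarrow> \<exists>(m, f)\<in>F. \<exists>p\<in>Inc_between m n.
      \<exists>u\<in>monomials c {1..n}. t = act_mon p (lead_mon r f) + u"
    and N: "N \<ge> 1"
  shows "stability_index c (initial_chain c r' J) \<le> N"
proof (rule stability_index_initial_chain_le[OF J r' N])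
  have id: "ideal (J n) (poly_ring c n)" if "n \<ge> 1" for n
    using J that unfolding Inc_invariant_chain_def by blast
  have leadF: "lead_mon r f \<in> leads r' (J m)" if "(m, f) \<in> F" for m f
    using F[OF that] unfolding leads_def by force
  fix n t
  assume n: "n \<ge> N" and t: "t \<in> leads r' (J n)"
  \<comment> \<open>Used twice: for the inclusion, and again for \<open>r'\<close> once equality is
    known.\<close>
  have factor: "\<exists>s\<in>leads r' (J N). \<exists>p\<in>Inc_between N n. \<exists>u\<in>monomials c {1..n}. t = act_mon p s + u"
    if t: "t \<in> leads r (J n)" for t
  proof -
    obtain m f p u where f: "(m, f) \<in> F" and p: "p \<in> Inc_between m n"
        and u: "u \<in> monomials c {1..n}" "t = act_mon p (lead_mon r f) + u"
      using gen[OF _ t] n N by fastforce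
    have m: "1 \<le> m" "m \<le> N" using F[OF f] by auto
    \<comment> \<open>A generator lives at level \<open>m\<close>, but the index asks for generators
      at level \<open>N\<close>; so \<open>p\<close> is split through \<open>N\<close>.\<close>
    obtain q' q where q: "q' \<in> Inc_between m N" "q \<in> Inc_between N n" "\<forall>j\<in>{1..m}. q (q' j) = p j"
      using Inc_factor[of p m N n] m n p unfolding Inc_between_def by auto
    have mon: "lead_mon r f \<in> monomials c {1..m}"
      using leadF[OF f] leads_monomials[OF id r'(1)] m by blast
    then have "act_mon p (lead_mon r f) = act_mon (q \<circ> q') (lead_mon r f)"
      by (rule act_mon_cong) (use q(3) in simp)
    also have "\<dots> = act_mon q (act_mon q' (lead_mon r f))"
      by (rule act_mon_comp[symmetric, where c = c])
        (use q mon monomials_interval_subset in \<open>auto simp: Inc_between_def\<close>)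
    finally have "t = act_mon q (act_mon q' (lead_mon r f)) + u" using u by simp
    moreover have "act_mon q' (lead_mon r f) \<in> leads r' (J N)"
      by (rule leads_act_mon[OF J r' m q(1) leadF[OF f]])
    ultimately show ?thesis using q(2) u(1) by blast
  qed
  have "leads r (J n) \<subseteq> leads r' (J n)"
  proof
    fix t assume "t \<in> leads r (J n)"
    then obtain s p u where s: "s \<in> leads r' (J N)" "p \<in> Inc_between N n" "u \<in> monomials c {1..n}"
        "t = act_mon p s + u"
      using factor by blast
    then show "t \<in> leads r' (J n)"
      using leads_add[OF id r'(1) leads_act_mon[OF J r' N n s(2,1)] s(3)] n N by simp
  qed
  then have "leads r (J n) = leads r' (J n)"
    by (rule leads_antimono_eq[OF id r(1) r'(1), rotated]) (use n N in simp)
  then show "\<exists>s\<in>leads r' (J N). \<exists>p\<in>Inc_between N n. \<exists>u\<in>monomials c {1..n}. t = act_mon p s + u"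
    using factor t by simp
qed

section \<open>Limits of term orders\<close>

text \<open>A limit of orders: membership of the pairs \<open>e 0, e 1, \<dots>\<close> is decided one at a time so that the
  sets agreeing with all decisions made so far keep unbounded \<open>\<iota>\<close>.\<close>

lemma limit_set:
  fixes T :: "'a set set" and \<iota> :: "'a set \<Rightarrow> nat" and e :: "nat \<Rightarrow> 'a"
  assumes unb: "\<And>N. \<exists>r\<in>T. \<iota> r > N"
  shows "\<exists>r. \<forall>F N. finite F \<and> F \<subseteq> range e \<longrightarrow> (\<exists>r'\<in>T. \<iota> r' > N \<and> r' \<inter> F = r \<inter> F)"
proof -
  define U where "U S \<longleftrightarrow> (\<forall>N. \<exists>r\<in>S. \<iota> r > N)" for S
  define S where "S n = rec_nat T
    (\<lambda>n S. if U {r\<in>S. e n \<in> r} then {r\<in>S. e n \<in> r} else {r\<in>S. e n \<notin> r}) n" for n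
  have S0: "S 0 = T" and SS: "S (Suc n) = (if U {r\<in>S n. e n \<in> r} then {r\<in>S n. e n \<in> r}
      else {r\<in>S n. e n \<notin> r})" for n
    by (simp_all add: S_def)
  have US: "U (S n)" for n
  proof (induction n)
    case 0
    show ?case using unb by (simp add: S0 U_def)
  next
    case (Suc n)
    show ?case
    \<comment> \<open>If both halves had bounded \<open>\<iota>\<close>, the larger bound would
      serve for all of \<open>S n\<close>.\<close>
    proof (rule ccontr)
      assume n: "\<not> U (S (Suc n))"
      then have "\<not> U {r\<in>S n. e n \<in> r}" "\<not> U {r\<in>S n. e n \<notin> r}"
        by (auto simp: SS split: if_splits)
      then obtain N N' where N: "\<And>r. r \<in> S n \<Longrightarrow> e n \<in> r \<Longrightarrow> \<iota> r \<le> N"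
          "\<And>r. r \<in> S n \<Longrightarrow> e n \<notin> r \<Longrightarrow> \<iota> r \<le> N'"
        unfolding U_def by (auto simp: not_less)
      obtain r where "r \<in> S n" "\<iota> r > max N N'" using Suc unfolding U_def by blast
      with N[of r] show False by (cases "e n \<in> r") auto
    qed
  qed
  have dec: "S (Suc n) \<subseteq> S n" for n by (auto simp: SS)
  have mono: "S n \<subseteq> S m" if "m \<le> n" for m n
    using that by (rule lift_Suc_antimono_le[of S, rotated]) (rule dec)
  define r where "r = {x. \<exists>n. \<forall>r'\<in>S n. x \<in> r'}"
  have eq: "e n \<in> r' \<longleftrightarrow> e n \<in> r" if "r' \<in> S (Suc n)" for n r'
  proof
    assume "e n \<in> r'"
    with that have "\<forall>r'\<in>S (Suc n). e n \<in> r'" by (auto simp: SS split: if_splits)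
    then show "e n \<in> r" unfolding r_def by blast
  next
    assume "e n \<in> r"
    then obtain m where m: "\<forall>r'\<in>S m. e n \<in> r'" unfolding r_def by blast
    \<comment> \<open>The stages are nested and nonempty: a common member carries the decision made
      at stage \<open>m\<close> to stage \<open>Suc n\<close>, where all members agree on
      \<open>e n\<close>.\<close>
    obtain s where "s \<in> S (max m (Suc n))" using US unfolding U_def by blast
    then have "s \<in> S m" "s \<in> S (Suc n)"
      using mono[of m "max m (Suc n)"] mono[of "Suc n" "max m (Suc n)"] by auto
    with m have "e n \<in> s" by blast
    with \<open>s \<in> S (Suc n)\<close> that show "e n \<in> r'" by (auto simp: SS split: if_splits)
  qed
  show ?thesis
  proof (intro exI[of _ r] allI impI)
    fix F N
    assume F: "finite F \<and> F \<subseteq> range e"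
    then obtain K where K: "finite K" "F = e ` K" by (metis finite_subset_image)
    then obtain b where b: "\<And>k. k \<in> K \<Longrightarrow> k < b"
      using finite_nat_bounded by (metis lessThan_iff subsetD)
    obtain r' where r': "r' \<in> S b" "\<iota> r' > N" using US unfolding U_def by blast
    have "r' \<in> S (Suc k)" if "k \<in> K" for k
      using mono[of "Suc k" b] b[OF that] r'(1) by auto
    then have "r' \<inter> F = r \<inter> F" using eq K(2) by auto
    moreover have "r' \<in> T" using mono[of 0 b] r'(1) S0 by auto
    ultimately show "\<exists>r'\<in>T. \<iota> r' > N \<and> r' \<inter> F = r \<inter> F" using r'(2) by blast
  qed
qed

text \<open>Lets the pairs of monomials be listed as a sequence for \<open>limit_set\<close>. A
  monomial is encoded by its finite graph over its keys.\<close>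

lemma countable_mons: "countable (UNIV :: mon set)"
proof -
  let ?g = "\<lambda>t :: mon. (\<lambda>k. (k, Poly_Mapping.lookup t k)) ` Poly_Mapping.keys t"
  have "inj ?g"
  proof (rule injI)
    fix s t :: mon
    assume eq: "?g s = ?g t"
    have "Poly_Mapping.lookup s k = v \<and> v \<noteq> 0 \<longleftrightarrow> (k, v) \<in> ?g s" for s :: mon and k v
      by (auto simp: in_keys_iff)
    with eq have "Poly_Mapping.lookup s k = v \<and> v \<noteq> 0 \<longleftrightarrow> Poly_Mapping.lookup t k = v \<and> v \<noteq> 0"
      for k v by metis
    then show "s = t" by (intro poly_mapping_eqI) metis
  qed
  moreover have "countable (range ?g)"
    by (rule countable_subset[OF _ countable_Collect_finite]) auto
  ultimately show ?thesis using countable_image_inj_eq by blast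
qed

text \<open>Every instance of an axiom concerns at most three pairs, so it can be read off from an
  order \<open>r'\<close> that agrees with \<open>r\<close> on them.\<close>

lemma term_order_limit:
  assumes "\<And>F. finite F \<Longrightarrow> \<exists>r'. term_order c r' \<and> Inc_compatible r' \<and> r' \<inter> F = r \<inter> F"
  shows "term_order c r \<and> Inc_compatible r"
proof -
  have ex: "\<exists>r'. term_order c r' \<and> Inc_compatible r' \<and> (\<forall>x\<in>set xs. x \<in> r' \<longleftrightarrow> x \<in> r)" for xs
    using assms[of "set xs"] by blast
  have "(x, z) \<in> r" if "(x, y) \<in> r" "(y, z) \<in> r" for x y z
  proof -
    obtain r' where "term_order c r'" "\<forall>p\<in>set [(x, y), (y, z), (x, z)]. p \<in> r' \<longleftrightarrow> p \<in> r" using ex by blast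
    then show ?thesis using that term_orderD(2)[of c r'] by (auto dest: transD)
  qed
  then have "trans r" by (rule transI)
  moreover have "x = y" if "(x, y) \<in> r" "(y, x) \<in> r" for x y
  proof -
    obtain r' where "term_order c r'" "\<forall>p\<in>set [(x, y), (y, x)]. p \<in> r' \<longleftrightarrow> p \<in> r" using ex by blast
    then show ?thesis using that term_orderD(1)[of c r'] by (auto dest: antisymD)
  qed
  then have "antisym r" by (rule antisymI)
  moreover have "x \<in> monomials c {1..} \<and> y \<in> monomials c {1..}" if "(x, y) \<in> r" for x y
  proof -
    obtain r' where "term_order c r'" "\<forall>p\<in>set [(x, y)]. p \<in> r' \<longleftrightarrow> p \<in> r" using ex by blast
    then show ?thesis using that term_orderD(3)[of c r'] by auto
  qed
  then have "r \<subseteq> monomials c {1..} \<times> monomials c {1..}" by auto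
  moreover have "(x, y) \<in> r \<or> (y, x) \<in> r" if "x \<in> monomials c {1..}" "y \<in> monomials c {1..}" for x y
  proof -
    obtain r' where "term_order c r'" "\<forall>p\<in>set [(x, y), (y, x)]. p \<in> r' \<longleftrightarrow> p \<in> r" using ex by blast
    then show ?thesis using that term_orderD(5)[of c r' x y] by auto
  qed
  moreover have "(s + u, t + u) \<in> r" if "u \<in> monomials c {1..}" "(s, t) \<in> r" for s t u
  proof -
    obtain r' where "term_order c r'" "\<forall>p\<in>set [(s, t), (s + u, t + u)]. p \<in> r' \<longleftrightarrow> p \<in> r" using ex by blast
    then show ?thesis using that term_orderD(6)[of c r' u s t] by auto
  qed
  moreover have "(0, u) \<in> r" if "u \<in> monomials c {1..}" for u
  proof -
    obtain r' where "term_order c r'" "\<forall>p\<in>set [(0, u)]. p \<in> r' \<longleftrightarrow> p \<in> r" using ex by blast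
    then show ?thesis using that by (auto simp: term_order_def)
  qed
  moreover have "(act_mon p s, act_mon p t) \<in> r" if "p \<in> Inc" "(s, t) \<in> r" for p s t
  proof -
    obtain r' where "Inc_compatible r'"
        "\<forall>x\<in>set [(s, t), (act_mon p s, act_mon p t)]. x \<in> r' \<longleftrightarrow> x \<in> r" using ex by blast
    then show ?thesis using that unfolding Inc_compatible_def by auto
  qed
  ultimately show ?thesis
    unfolding term_order_def Inc_compatible_def order_on_defs refl_on_def total_on_def by blast
qed

section \<open>Boundedness of the indices by compactness\<close>

theorem theorem1p2:
  fixes c :: nat and J :: "nat \<Rightarrow> 'k::field mpoly set"
  assumes "c \<ge> 1" and "Inc_invariant_chain c J"
  shows "bdd_above (initial_indices c J) \<and> finite (initial_indices c J)"
proof -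
  have J: "Inc_invariant_chain c J" by fact
  have id: "ideal (J n) (poly_ring c n)" if "n \<ge> 1" for n
    using J that unfolding Inc_invariant_chain_def by blast
  define T where "T = {r. term_order c r \<and> Inc_compatible r}"
  define \<iota> where "\<iota> r = stability_index c (initial_chain c r J)" for r
  have "\<exists>N. \<forall>r\<in>T. \<iota> r \<le> N"
  proof (rule ccontr)
    assume "\<nexists>N. \<forall>r\<in>T. \<iota> r \<le> N"
    then have unb: "\<exists>r\<in>T. \<iota> r > N" for N by (meson not_le)
    have "countable (UNIV :: mon rel)"
      using countable_SIGMA[OF countable_mons countable_mons] by simp
    then have e: "range (from_nat_into (UNIV :: mon rel)) = UNIV" by (intro range_from_nat_into) auto
    obtain r where lim: "\<forall>F N. finite F \<longrightarrow> (\<exists>r'\<in>T. \<iota> r' > N \<and> r' \<inter> F = r \<inter> F)"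
      using limit_set[of T \<iota> "from_nat_into (UNIV :: mon rel)", OF unb] e by auto
    have "term_order c r \<and> Inc_compatible r"
    proof (rule term_order_limit)
      fix F :: "mon rel"
      assume "finite F"
      then obtain r' where "r' \<in> T" "r' \<inter> F = r \<inter> F" using lim by blast
      then show "\<exists>r'. term_order c r' \<and> Inc_compatible r' \<and> r' \<inter> F = r \<inter> F"
        unfolding T_def by blast
    qed
    then have r: "term_order c r" "Inc_compatible r" by blast+
    obtain B where B: "finite B" "B \<subseteq> {(m, s). m \<ge> 1 \<and> s \<in> leads r (J m)}"
      and gen: "\<forall>n\<ge>1. \<forall>t\<in>leads r (J n).
        \<exists>(m, s)\<in>B. \<exists>p\<in>Inc_between m n. \<exists>u\<in>monomials c {1..n}. t = act_mon p s + u"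
      using monomials_finite_basis[of "\<lambda>n. leads r (J n)" c, OF leads_monomials[OF id r(1)]]
      by blast
    have "\<forall>b\<in>B. \<exists>f. f \<in> J (fst b) \<and> f \<noteq> 0 \<and> lead_mon r f = snd b"
      using B(2) unfolding leads_def by fastforce
    then obtain g where g: "\<And>b. b \<in> B \<Longrightarrow> g b \<in> J (fst b) \<and> g b \<noteq> 0 \<and> lead_mon r (g b) = snd b"
      by metis
    define F where "F = (\<lambda>b. (fst b, g b)) ` B"
    \<comment> \<open>The 1 covers an empty \<open>B\<close>, as for the zero chain, since levels
      start at 1.\<close>
    define N where "N = Max (insert 1 (fst ` B))"
    \<comment> \<open>To fix a leading monomial it suffices to compare the monomials of one
      polynomial with each other, which makes \<open>K\<close> finite.\<close>
    define K where "K = (\<Union>b\<in>B. Poly_Mapping.keys (g b) \<times> Poly_Mapping.keys (g b))"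
    have "finite K" unfolding K_def using B(1) by simp
    then obtain r' where r': "r' \<in> T" "\<iota> r' > N" "r' \<inter> K = r \<inter> K" using lim by blast
    have "\<iota> r' \<le> N" unfolding \<iota>_def
    proof (rule stability_index_le_of_agree[OF J r])
      show "term_order c r'" "Inc_compatible r'" using r'(1) by (auto simp: T_def)
      show "N \<ge> 1" using B(1) by (simp add: N_def)
      show "1 \<le> m \<and> m \<le> N \<and> f \<in> J m \<and> f \<noteq> 0 \<and> lead_mon r' f = lead_mon r f"
        if mf: "(m, f) \<in> F" for m f
      proof -
        obtain b where b: "b \<in> B" "m = fst b" "f = g b" using mf unfolding F_def by blast
        have "m \<ge> 1" using B(2) b by auto
        have "m \<le> N" unfolding N_def using B(1) b by (intro Max_ge) auto
        have f: "f \<in> J m" "f \<noteq> 0" using g[OF b(1)] b by auto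
        have "Poly_Mapping.keys f \<subseteq> monomials c {1..}"
          using poly_ring_idealD(1)[OF id[OF \<open>m \<ge> 1\<close>] f(1)] monomials_interval_subset by blast
        note lead = lead_mon_greatest[OF r(1) f(2) this]
        have "lead_mon r' f = lead_mon r f"
        proof (rule lead_mon_eq)
          show "antisym r'" using r'(1) term_orderD(1) by (auto simp: T_def)
          show "lead_mon r f \<in> Poly_Mapping.keys f" by (rule lead(1))
          fix s assume "s \<in> Poly_Mapping.keys f"
          then have "(s, lead_mon r f) \<in> r \<inter> K" using lead b unfolding K_def by blast
          then show "(s, lead_mon r f) \<in> r'" using r'(3) by blast
        qed
        with f \<open>m \<ge> 1\<close> \<open>m \<le> N\<close> show ?thesis by simp
      qed
      show "\<exists>(m, f)\<in>F. \<exists>p\<in>Inc_between m n. \<exists>u\<in>monomials c {1..n}. t = act_mon p (lead_mon r f) + u"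
        if nt: "n \<ge> 1" "t \<in> leads r (J n)" for n t
      proof -
        obtain m s where ms: "(m, s) \<in> B"
            "\<exists>p\<in>Inc_between m n. \<exists>u\<in>monomials c {1..n}. t = act_mon p s + u"
          using gen nt by blast
        then have "(m, g (m, s)) \<in> F" "lead_mon r (g (m, s)) = s"
          using g[OF ms(1)] unfolding F_def by (auto intro: image_eqI[of _ _ "(m, s)"])
        with ms(2) show ?thesis by (intro bexI[of _ "(m, g (m, s))"]) auto
      qed
    qed
    with r'(2) show False by simp
  qed
  then obtain N where N: "\<And>r. r \<in> T \<Longrightarrow> \<iota> r \<le> N" by blast
  have "x \<le> N" if "x \<in> initial_indices c J" for x
    using that N unfolding initial_indices_def T_def \<iota>_def by blast
  then have "bdd_above (initial_indices c J)" by (rule bdd_aboveI)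
  then show ?thesis by (simp add: bdd_above_nat)
qed

end
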